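(* Let $f:\{0,1\}^n\to\mathbb{R}$ be a submodular function with $f(\mathbf 0)=0$, and let $\tilde x\in\mathbb{R}^n$ be arbitrary (entries of any sign). Let $\pi^*$ be a permutation of $[n]=\{1,\dots,n\}$ output by the sorting algorithm, i.e. such that $\tilde x_{\pi^*(1)}\ge\tilde x_{\pi^*(2)}\ge\cdots\ge\tilde x_{\pi^*(n)}$. Then the output $\sigma(\pi^* )$ of the sorting algorithm is an optimal solution of the extended polymatroid vertex maximization problem $$\max_{s\in\mathrm{ext}(EPM_f)} s\tilde x .$$
   Context: $f$ is submodular if $f(x)+f(y)\ge f(x\vee y)+f(x\wedge y)$ for all $x,y\in\{0,1\}^n$ (componentwise max and min). The product $sx$ of two vectors is the inner product. The extended polymatroid is $EPM_f:=\{s\in\mathbb{R}^n: sx\le f(x)\ \forall x\in\{0,1\}^n\}$, with vertex set $\mathrm{ext}(EPM_f)$. For a permutation $\pi$ of $[n]$ and $i\in\{0,\dots,n\}$, let $v^i(\pi)\in\{0,1\}^n$ be the characteristic vector of $\{\pi(1),\dots,\pi(i)\}$ (so $v^0(\pi)=\mathbf 0$). The vector $\sigma(\pi)\in\mathbb{R}^n$ is defined by $\sigma(\pi)_{\pi(i)}=f(v^i(\pi))-f(v^{i-1}(\pi))$ for $i\in[n]$. The sorting algorithm sorts the entries of $\tilde x$ in non-increasing order to obtain $\pi^*$ and outputs $\sigma(\pi^* )$. *)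

theory Defs
  imports "HOL-Analysis.Analysis"
begin

text \<open>
  The index set \<open>[n]\<close> is rendered by a finite type \<open>'n\<close> with \<open>n = CARD('n)\<close>, and a permutation of
  \<open>[n]\<close> by an enumeration of the coordinates, i.e. a bijection from \<open>{1..CARD('n)}\<close> onto \<open>'n\<close>.
  A function on \<open>{0,1}\<close>-vectors is given by \<open>f :: real ^ 'n \<Rightarrow> real\<close>; every definition below uses
  only the values of \<open>f\<close> on \<open>binary_vectors\<close>.
\<close>

definition binary_vectors :: "(real ^ 'n) set" where
  "binary_vectors = {x. \<forall>j. x $ j \<in> {0, 1}}"

text \<open>On \<open>real ^ 'n\<close>, \<open>sup\<close> and \<open>inf\<close> are the componentwise maximum and minimum.\<close>

definition submodular :: "(real ^ 'n \<Rightarrow> real) \<Rightarrow> bool" where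
  "submodular f \<longleftrightarrow>
     (\<forall>x\<in>binary_vectors. \<forall>y\<in>binary_vectors. f x + f y \<ge> f (sup x y) + f (inf x y))"

definition EPM :: "(real ^ 'n \<Rightarrow> real) \<Rightarrow> (real ^ 'n) set" where
  "EPM f = {s. \<forall>x\<in>binary_vectors. s \<bullet> x \<le> f x}"

definition vertices :: "(real ^ 'n) set \<Rightarrow> (real ^ 'n) set" where
  "vertices P = {s. s extreme_point_of P}"

definition is_permutation :: "(nat \<Rightarrow> 'n::finite) \<Rightarrow> bool" where
  "is_permutation \<pi> \<longleftrightarrow> bij_betw \<pi> {1..CARD('n)} UNIV"

definition prefix_vec :: "(nat \<Rightarrow> 'n) \<Rightarrow> nat \<Rightarrow> real ^ 'n" where
  "prefix_vec \<pi> i = (\<chi> j. if j \<in> \<pi> ` {1..i} then 1 else 0)"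

definition sigma_vec :: "(real ^ 'n \<Rightarrow> real) \<Rightarrow> (nat \<Rightarrow> 'n::finite) \<Rightarrow> real ^ 'n" where
  "sigma_vec f \<pi> =
     (\<chi> j. let i = inv_into {1..CARD('n)} \<pi> j
           in f (prefix_vec \<pi> i) - f (prefix_vec \<pi> (i - 1)))"

lemma sigma_vec_nth:
  fixes \<pi> :: "nat \<Rightarrow> 'n::finite"
  assumes "is_permutation \<pi>" and "i \<in> {1..CARD('n)}"
  shows "sigma_vec f \<pi> $ \<pi> i = f (prefix_vec \<pi> i) - f (prefix_vec \<pi> (i - 1))"
  using assms by (simp add: sigma_vec_def is_permutation_def bij_betw_def inv_into_f_f Let_def)

definition sorting_permutation :: "real ^ 'n \<Rightarrow> (nat \<Rightarrow> 'n::finite) \<Rightarrow> bool" where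
  "sorting_permutation x \<pi> \<longleftrightarrow>
     is_permutation \<pi> \<and> (\<forall>i\<in>{1..<CARD('n)}. x $ \<pi> i \<ge> x $ \<pi> (i + 1))"

definition optimal_solution :: "(real ^ 'n) set \<Rightarrow> real ^ 'n \<Rightarrow> real ^ 'n \<Rightarrow> bool" where
  "optimal_solution S x s \<longleftrightarrow> s \<in> S \<and> (\<forall>t\<in>S. t \<bullet> x \<le> s \<bullet> x)"

end

theory Submission
  imports Defs
begin

text \<open>
  Identify a \<open>{0,1}\<close>-vector with the set of coordinates where it is \<open>1\<close>, so that \<open>f\<close> becomes
  a submodular set function and \<open>EPM f\<close> is cut out by one inequality per set; call a set tight
  for \<open>s\<close> if its inequality holds with equality.

  The vector \<open>\<sigma>\<close> is defined so that every prefix of the ordering is tight for it.  It is feasible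
  because, by submodularity, an element contributes at least as much to a subset of a prefix as
  it does to the whole prefix (\<open>sigma_vec_in_EPM\<close>).  It is an extreme point because the \<open>n\<close> prefix
  inequalities are tight and together determine every coordinate (\<open>sigma_vec_in_vertices\<close>).

  For optimality, summation by parts writes \<open>(\<sigma> - t) \<bullet> x\<close> in terms of the partial sums of
  \<open>\<sigma> - t\<close> along the ordering.  These are nonnegative, as \<open>\<sigma>\<close> attains the bounds that
  \<open>t\<close> only satisfies, and all but the last are weighted by differences of consecutive sorted entries
  of \<open>x\<close>, which are nonnegative.  The last one is weighted by the smallest entry of \<open>x\<close>, whose sign
  is arbitrary, so for general \<open>t \<in> EPM f\<close> the argument would fail.  But at a vertex \<open>t\<close> the full
  coordinate set is tight (\<open>vertices_EPM_tight_UNIV\<close>), and the last partial sum vanishes.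
\<close>

section \<open>Binary vectors as sets\<close>

definition char_vec :: "'n set \<Rightarrow> real ^ 'n" where
  "char_vec A = (\<chi> j. if j \<in> A then 1 else 0)"

lemma inner_char_vec: "s \<bullet> char_vec A = (\<Sum>j\<in>A. s $ j)" for s :: "real ^ 'n"
  by (simp add: inner_vec_def char_vec_def if_distrib sum.If_cases cong: if_cong)

lemma binary_vectors_eq: "binary_vectors = range char_vec"
proof
  show "binary_vectors \<subseteq> (range char_vec :: (real ^ 'n) set)"
  proof
    fix x :: "real ^ 'n" assume "x \<in> binary_vectors"
    then have "x = char_vec {j. x $ j = 1}"
      by (auto simp: binary_vectors_def char_vec_def vec_eq_iff)
    then show "x \<in> range char_vec" by blast
  qed
qed (auto simp: binary_vectors_def char_vec_def)

lemma mem_EPM_iff: "s \<in> EPM f \<longleftrightarrow> (\<forall>A. (\<Sum>j\<in>A. s $ j) \<le> f (char_vec A))"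
  by (simp add: EPM_def binary_vectors_eq inner_char_vec)

lemma submodular_char_vec:
  assumes "submodular f"
  shows "f (char_vec (A \<union> B)) + f (char_vec (A \<inter> B)) \<le> f (char_vec A) + f (char_vec B)"
proof -
  have "char_vec (A \<union> B) = sup (char_vec A) (char_vec B)"
    and "char_vec (A \<inter> B) = inf (char_vec A) (char_vec B)"
    by (auto simp: vec_eq_iff char_vec_def sup_vec_def inf_vec_def sup_max inf_min)
  then show ?thesis
    using assms by (auto simp: submodular_def binary_vectors_eq)
qed

lemma char_vec_empty [simp]: "char_vec {} = 0"
  by (simp add: char_vec_def vec_eq_iff)

lemma prefix_vec_eq_char_vec: "prefix_vec \<pi> i = char_vec (\<pi> ` {1..i})"
  by (simp add: prefix_vec_def char_vec_def)

lemma sum_permutation_prefix: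
  fixes \<pi> :: "nat \<Rightarrow> 'n::finite"
  assumes "is_permutation \<pi>" and "i \<le> CARD('n)"
  shows "(\<Sum>j\<in>\<pi> ` {1..i}. g j) = (\<Sum>k=1..i. g (\<pi> k))"
proof -
  have "inj_on \<pi> {1..i}"
    using assms by (auto simp: is_permutation_def bij_betw_def intro: inj_on_subset)
  then show ?thesis by (simp add: sum.reindex)
qed

lemma EPM_sum_prefix_le:
  fixes \<pi> :: "nat \<Rightarrow> 'n::finite"
  assumes "s \<in> EPM f" and "is_permutation \<pi>" and "i \<le> CARD('n)"
  shows "(\<Sum>k=1..i. s $ \<pi> k) \<le> f (char_vec (\<pi> ` {1..i}))"
  using assms(1) sum_permutation_prefix[OF assms(2,3), of "($) s"] unfolding mem_EPM_iff by metis

lemma permutation_image_UNIV: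
  fixes \<pi> :: "nat \<Rightarrow> 'n::finite"
  assumes "is_permutation \<pi>"
  shows "\<pi> ` {1..CARD('n)} = UNIV"
  using assms by (simp add: is_permutation_def bij_betw_def)

section \<open>The vector of marginal values is a vertex\<close>

text \<open>The marginal values telescope, so each prefix is tight.\<close>

lemma sigma_vec_tight_prefix:
  fixes \<pi> :: "nat \<Rightarrow> 'n::finite"
  assumes "f 0 = 0" and "is_permutation \<pi>" and "i \<le> CARD('n)"
  shows "(\<Sum>k=1..i. sigma_vec f \<pi> $ \<pi> k) = f (char_vec (\<pi> ` {1..i}))"
  using assms(3)
proof (induction i)
  case 0
  then show ?case using assms(1) by simp
next
  case (Suc i)
  then show ?case
    using sigma_vec_nth[OF assms(2), of "Suc i" f] by (simp add: prefix_vec_eq_char_vec)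
qed

text \<open>
  A set \<open>A\<close> is built up by intersecting it with longer and longer prefixes.  When the next
  element lies in \<open>A\<close>, apply submodularity to the old prefix and to the intersection of \<open>A\<close> with
  the new one: their union is the new prefix, and their intersection is the previous stage
  of \<open>A\<close>.  So the marginal value of the element is at most the growth of \<open>f\<close> on \<open>A\<close>.
\<close>

lemma sigma_vec_in_EPM:
  fixes \<pi> :: "nat \<Rightarrow> 'n::finite"
  assumes sub: "submodular f" and f0: "f 0 = 0" and perm: "is_permutation \<pi>"
  shows "sigma_vec f \<pi> \<in> EPM f"
  unfolding mem_EPM_iff
proof
  fix A :: "'n set"
  let ?s = "sigma_vec f \<pi>" and ?P = "\<lambda>i. \<pi> ` {1..i}"
  have "(\<Sum>j\<in>A \<inter> ?P i. ?s $ j) \<le> f (char_vec (A \<inter> ?P i))" if "i \<le> CARD('n)" for i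
    using that
  proof (induction i)
    case 0
    then show ?case using f0 by simp
  next
    case (Suc i)
    have P_Suc: "?P (Suc i) = insert (\<pi> (Suc i)) (?P i)"
      by (auto simp: atLeastAtMostSuc_conv)
    have IH: "(\<Sum>j\<in>A \<inter> ?P i. ?s $ j) \<le> f (char_vec (A \<inter> ?P i))"
      using Suc by simp
    show ?case
    proof (cases "\<pi> (Suc i) \<in> A")
      case False
      then have "A \<inter> ?P (Suc i) = A \<inter> ?P i" using P_Suc by auto
      then show ?thesis using IH by simp
    next
      case True
      have "inj_on \<pi> {1..CARD('n)}"
        using perm by (simp add: is_permutation_def bij_betw_def)
      then have new: "\<pi> (Suc i) \<notin> ?P i"
        using Suc.prems by (force dest: inj_onD)
      have split: "A \<inter> ?P (Suc i) = insert (\<pi> (Suc i)) (A \<inter> ?P i)"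
        using True P_Suc by auto
      have "(A \<inter> ?P (Suc i)) \<union> ?P i = ?P (Suc i)" and "(A \<inter> ?P (Suc i)) \<inter> ?P i = A \<inter> ?P i"
        using True P_Suc by auto
      then have "f (char_vec (?P (Suc i))) + f (char_vec (A \<inter> ?P i))
          \<le> f (char_vec (A \<inter> ?P (Suc i))) + f (char_vec (?P i))"
        using submodular_char_vec[OF sub, of "A \<inter> ?P (Suc i)" "?P i"] by simp
      moreover have "?s $ \<pi> (Suc i) = f (char_vec (?P (Suc i))) - f (char_vec (?P i))"
        using sigma_vec_nth[OF perm, of "Suc i" f] Suc.prems by (simp add: prefix_vec_eq_char_vec)
      moreover have "(\<Sum>j\<in>A \<inter> ?P (Suc i). ?s $ j) = ?s $ \<pi> (Suc i) + (\<Sum>j\<in>A \<inter> ?P i. ?s $ j)"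
        unfolding split using new by simp
      ultimately show ?thesis using IH by linarith
    qed
  qed
  from this[of "CARD('n)"] show "(\<Sum>j\<in>A. ?s $ j) \<le> f (char_vec A)"
    using permutation_image_UNIV[OF perm] by simp
qed

text \<open>
  A tight inequality stays tight at both ends of any segment in \<open>EPM f\<close> with the point in its
  interior.  Consecutive prefixes differ in a single coordinate, so both ends agree with \<open>\<sigma>\<close>
  everywhere and the segment degenerates.
\<close>

lemma sigma_vec_in_vertices:
  fixes \<pi> :: "nat \<Rightarrow> 'n::finite"
  assumes sub: "submodular f" and f0: "f 0 = 0" and perm: "is_permutation \<pi>"
  shows "sigma_vec f \<pi> \<in> vertices (EPM f)"
proof -
  let ?s = "sigma_vec f \<pi>" and ?P = "\<lambda>i. \<pi> ` {1..i}"
  have False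
    if a: "a \<in> EPM f" and b: "b \<in> EPM f" and seg: "?s \<in> open_segment a b" for a b
  proof -
    from seg obtain u where "a \<noteq> b" and u: "0 < u" "u < 1"
      and s: "?s = (1 - u) *\<^sub>R a + u *\<^sub>R b"
      by (auto simp: in_segment)
    have tight: "(\<Sum>k=1..i. a $ \<pi> k) = (\<Sum>k=1..i. b $ \<pi> k)" if i: "i \<le> CARD('n)" for i
    proof -
      let ?a = "\<Sum>k=1..i. a $ \<pi> k" and ?b = "\<Sum>k=1..i. b $ \<pi> k" and ?c = "f (char_vec (?P i))"
      have "?a \<le> ?c" and "?b \<le> ?c"
        using EPM_sum_prefix_le[OF a perm i] EPM_sum_prefix_le[OF b perm i] by blast+
      moreover have "(1 - u) * ?a + u * ?b = ?c"
        using sigma_vec_tight_prefix[of f, OF f0 perm i]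
        by (simp add: s sum.distrib sum_distrib_left)
      then have "(1 - u) * (?c - ?a) + u * (?c - ?b) = 0"
        by (simp add: algebra_simps)
      ultimately show ?thesis
        using u by (simp add: add_nonneg_eq_0_iff)
    qed
    have "a $ j = b $ j" for j
    proof -
      obtain i where i: "i \<in> {1..CARD('n)}" and j: "j = \<pi> i"
        using permutation_image_UNIV[OF perm] by blast
      from i obtain m where m: "i = Suc m" by (cases i) auto
      then show ?thesis
        using tight[of "Suc m"] tight[of m] i j by simp
    qed
    with \<open>a \<noteq> b\<close> show False by (simp add: vec_eq_iff)
  qed
  then show ?thesis
    using sigma_vec_in_EPM[OF assms] by (auto simp: vertices_def extreme_point_of_def)
qed

section \<open>Vertices make the full coordinate set tight\<close>

text \<open>
  The two inequalities for \<open>A \<union> B\<close> and \<open>A \<inter> B\<close> add up, by submodularity, to one that is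
  tight; hence each of them is.
\<close>

lemma tight_Un:
  fixes f :: "real ^ 'n \<Rightarrow> real"
  assumes sub: "submodular f" and t: "t \<in> EPM f"
    and A: "(\<Sum>j\<in>A. t $ j) = f (char_vec A)" and B: "(\<Sum>j\<in>B. t $ j) = f (char_vec B)"
  shows "(\<Sum>j\<in>A \<union> B. t $ j) = f (char_vec (A \<union> B))"
proof -
  have "(\<Sum>j\<in>A \<union> B. t $ j) + (\<Sum>j\<in>A \<inter> B. t $ j) = (\<Sum>j\<in>A. t $ j) + (\<Sum>j\<in>B. t $ j)"
    by (simp add: sum.union_inter)
  moreover have "(\<Sum>j\<in>A \<union> B. t $ j) \<le> f (char_vec (A \<union> B))"
    and "(\<Sum>j\<in>A \<inter> B. t $ j) \<le> f (char_vec (A \<inter> B))"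
    using t by (simp_all add: mem_EPM_iff)
  ultimately show ?thesis
    using submodular_char_vec[OF sub, of A B] A B by linarith
qed

text \<open>
  Lowering a coordinate never leaves \<open>EPM f\<close>.  If coordinate \<open>j\<close> were in no tight set, it could
  also be raised by the smallest slack of the sets containing it, and the point would be the
  midpoint of a segment.
\<close>

lemma vertices_EPM_coordinate_tight:
  fixes f :: "real ^ 'n \<Rightarrow> real"
  assumes t: "t \<in> vertices (EPM f)"
  shows "\<exists>A. j \<in> A \<and> (\<Sum>i\<in>A. t $ i) = f (char_vec A)"
proof (rule ccontr)
  assume no_tight: "\<nexists>A. j \<in> A \<and> (\<Sum>i\<in>A. t $ i) = f (char_vec A)"
  have t_EPM: "t \<in> EPM f" and ext: "t extreme_point_of EPM f"
    using t by (auto simp: vertices_def extreme_point_of_def)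
  define e where "e = Min ((\<lambda>A. f (char_vec A) - (\<Sum>i\<in>A. t $ i)) ` {A. j \<in> A})"
  have fin: "finite {A. j \<in> A}" and ne: "{A. j \<in> A} \<noteq> {}" by auto
  have slack: "(\<Sum>i\<in>A. t $ i) < f (char_vec A)" if "j \<in> A" for A
    using no_tight t_EPM that by (auto simp: mem_EPM_iff less_le)
  have e_pos: "0 < e"
    unfolding e_def using fin ne slack by (subst Min_gr_iff) auto
  have e_le: "e \<le> f (char_vec A) - (\<Sum>i\<in>A. t $ i)" if "j \<in> A" for A
    unfolding e_def using fin that by (intro Min_le) auto
  have sum_shift: "(\<Sum>i\<in>A. (t + c *\<^sub>R axis j 1) $ i) = (\<Sum>i\<in>A. t $ i) + (if j \<in> A then c else 0)"
    for c :: real and A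
  proof -
    have "(t + c *\<^sub>R axis j 1) $ i = t $ i + (if i = j then c else 0)" for i
      by (simp add: axis_def)
    then show ?thesis by (simp only: sum.distrib) simp
  qed
  have "t + e *\<^sub>R axis j 1 \<in> EPM f"
    unfolding mem_EPM_iff sum_shift using e_le t_EPM by (auto simp: mem_EPM_iff algebra_simps)
  moreover have "t + (- e) *\<^sub>R axis j 1 \<in> EPM f"
    unfolding mem_EPM_iff sum_shift using e_pos t_EPM
    by (auto simp: mem_EPM_iff intro: order_trans[rotated])
  moreover have "t = midpoint (t + e *\<^sub>R axis j 1) (t + (- e) *\<^sub>R axis j 1)"
    by (simp add: midpoint_def flip: scaleR_2)
  moreover have "t + e *\<^sub>R axis j 1 \<noteq> t + (- e) *\<^sub>R axis j 1"
    using e_pos by (simp add: vec_eq_iff axis_def exI[of _ j])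
  ultimately show False
    using ext midpoint_in_open_segment unfolding extreme_point_of_def by metis
qed

text \<open>The union of the tight sets covering the single coordinates is everything.\<close>

lemma vertices_EPM_tight_UNIV:
  fixes f :: "real ^ 'n \<Rightarrow> real"
  assumes sub: "submodular f" and f0: "f 0 = 0" and t: "t \<in> vertices (EPM f)"
  shows "(\<Sum>j\<in>UNIV. t $ j) = f (char_vec UNIV)"
proof -
  have t_EPM: "t \<in> EPM f"
    using t by (simp add: vertices_def extreme_point_of_def)
  have "\<exists>A. J \<subseteq> A \<and> (\<Sum>i\<in>A. t $ i) = f (char_vec A)" for J :: "'n set"
    using finite[of J]
  proof (induction rule: finite_induct)
    case empty
    show ?case using f0 by (intro exI[of _ "{}"]) simp
  next
    case (insert j J)
    then obtain A where "J \<subseteq> A" "(\<Sum>i\<in>A. t $ i) = f (char_vec A)" by blast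
    moreover obtain B where "j \<in> B" "(\<Sum>i\<in>B. t $ i) = f (char_vec B)"
      using vertices_EPM_coordinate_tight[OF t] by blast
    ultimately show ?case
      using tight_Un[OF sub t_EPM, of A B] by (intro exI[of _ "A \<union> B"]) auto
  qed
  from this[of UNIV] show ?thesis by (simp add: top.extremum_unique)
qed

section \<open>Optimality\<close>

text \<open>
  An inequality form of summation by parts: passing from \<open>m\<close> to \<open>m + 1\<close>, the weight of the
  nonnegative partial sum drops from \<open>x m\<close> to \<open>x (m + 1)\<close>.
\<close>

lemma sum_mult_ge_last_mult_sum:
  fixes d x :: "nat \<Rightarrow> real"
  assumes "\<And>i. i < m \<Longrightarrow> 0 \<le> (\<Sum>k=1..i. d k)"
    and "\<And>i. 1 \<le> i \<Longrightarrow> i < m \<Longrightarrow> x (Suc i) \<le> x i"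
  shows "x m * (\<Sum>k=1..m. d k) \<le> (\<Sum>k=1..m. d k * x k)"
  using assms
proof (induction m)
  case 0
  then show ?case by simp
next
  case (Suc m)
  have "x (Suc m) * (\<Sum>k=1..m. d k) \<le> x m * (\<Sum>k=1..m. d k)"
  proof (cases "m = 0")
    case False
    then show ?thesis using Suc.prems by (intro mult_right_mono) auto
  qed simp
  moreover have "x m * (\<Sum>k=1..m. d k) \<le> (\<Sum>k=1..m. d k * x k)"
    using Suc by simp
  ultimately show ?case by (simp add: algebra_simps)
qed

theorem proposition3:
  fixes f :: "real ^ 'n \<Rightarrow> real" and x :: "real ^ 'n" and \<pi> :: "nat \<Rightarrow> 'n"
  assumes "submodular f"
    and "f 0 = 0"
    and "sorting_permutation x \<pi>"
  shows "optimal_solution (vertices (EPM f)) x (sigma_vec f \<pi>)"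
proof -
  let ?s = "sigma_vec f \<pi>" and ?n = "CARD('n)"
  have perm: "is_permutation \<pi>"
    and sorted: "\<And>i. 1 \<le> i \<Longrightarrow> i < ?n \<Longrightarrow> x $ \<pi> (Suc i) \<le> x $ \<pi> i"
    using assms(3) by (auto simp: sorting_permutation_def)
  have sum_UNIV: "(\<Sum>j\<in>UNIV. g j) = (\<Sum>k=1..?n. g (\<pi> k))" for g :: "'n \<Rightarrow> real"
    using sum_permutation_prefix[OF perm order_refl, of g] permutation_image_UNIV[OF perm] by simp
  have "t \<bullet> x \<le> ?s \<bullet> x" if t: "t \<in> vertices (EPM f)" for t
  proof -
    let ?d = "\<lambda>k. (?s - t) $ \<pi> k"
    have t_EPM: "t \<in> EPM f"
      using t by (simp add: vertices_def extreme_point_of_def)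
    have nonneg: "0 \<le> (\<Sum>k=1..i. ?d k)" if i: "i \<le> ?n" for i
    proof -
      have "(\<Sum>k=1..i. t $ \<pi> k) \<le> f (char_vec (\<pi> ` {1..i}))"
        by (rule EPM_sum_prefix_le[OF t_EPM perm i])
      then show ?thesis
        using sigma_vec_tight_prefix[of f, OF assms(2) perm i] by (simp add: sum_subtractf)
    qed
    have "(\<Sum>k=1..?n. t $ \<pi> k) = f (char_vec UNIV)"
      using vertices_EPM_tight_UNIV[OF assms(1,2) t] by (simp add: sum_UNIV)
    then have total: "(\<Sum>k=1..?n. ?d k) = 0"
      using sigma_vec_tight_prefix[of f, OF assms(2) perm order_refl] permutation_image_UNIV[OF perm]
      by (simp add: sum_subtractf)
    have "x $ \<pi> ?n * (\<Sum>k=1..?n. ?d k) \<le> (\<Sum>k=1..?n. ?d k * x $ \<pi> k)"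
      by (rule sum_mult_ge_last_mult_sum) (use nonneg sorted in auto)
    also have "\<dots> = (?s - t) \<bullet> x"
      by (simp add: inner_vec_def sum_UNIV)
    finally show ?thesis
      by (simp only: total inner_diff_left mult_zero_right diff_ge_0_iff_ge)
  qed
  then show ?thesis
    using sigma_vec_in_vertices[OF assms(1,2) perm] by (simp add: optimal_solution_def)
qed

end
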